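(* Let $\Omega\subset\mathbb{R}^n$ be open and bounded with collar $\Gamma$, and let $r\ge1$. Let $\mu:\mathbb{R}^n\times\mathbb{R}^n\to[0,\infty)$ satisfy $\mu\in L^1(\mathbb{R}^n\times\mathbb{R}^n)$, $\bigcup_{x\in\Omega}\operatorname{supp}\mu(x,\cdot)\setminus\Omega\subseteq\Gamma$, $\mu(\cdot,y)\in L^1(\mathbb{R}^n)$ for a.e. $y$, and $\mu(x,\cdot)\in L^1(\mathbb{R}^n)$ for a.e. $x$. Assume $\gamma_\mu,\lambda_\mu\in L^\infty(\mathbb{R}^n)$ and $1-M_{\mu,r}\left\|\frac1{\lambda_\mu}\right\|_{L^\infty(\Omega\cup\Gamma)}>0$. For $i=1,2$ let $u_i$ solve $$\mathcal{L}_\mu u_i(x)=f_i(x)\ \ (x\in\Omega),\qquad u_i(x)=g(x)\ \ (x\in\Gamma).$$ Then $$\|u_2-u_1\|_{L^r(\Omega)}\le C_2\|f_2-f_1\|_{L^r(\Omega)},\qquad C_2:=\frac{\left\|\frac1{\lambda_\mu}\right\|_{L^\infty(\Omega\cup\Gamma)}}{1-M_{\mu,r}\left\|\frac1{\lambda_\mu}\right\|_{L^\infty(\Omega\cup\Gamma)}} .$$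
   Context: The nonlocal Laplacian is $\mathcal{L}_\mu u(x)=\int_{\mathbb{R}^n}(u(y)-u(x))\,\mu(x,y)\,dy$. The collar $\Gamma\subset\mathbb{R}^n\setminus\Omega$ is a measurable set; functions on $\Omega\cup\Gamma$ are extended by zero to $\mathbb{R}^n$. Define $\gamma_\mu(y):=\|\mu(\cdot,y)\|_{L^1(\mathbb{R}^n)}$, $\lambda_\mu(x):=\|\mu(x,\cdot)\|_{L^1(\mathbb{R}^n)}$ and $M_{\mu,r}:=\|\gamma_\mu\|_{L^\infty(\mathbb{R}^n)}^{1/r}\,\|\lambda_\mu\|_{L^\infty(\mathbb{R}^n)}^{1-1/r}$. Data and solutions are measurable with $f_i\in L^r(\Omega)$, $u_i\in L^r(\Omega\cup\Gamma)$. *)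

theory Defs
  imports "HOL-Analysis.Analysis" "HOL-Probability.Essential_Supremum"
begin

definition Lp_space :: "real \<Rightarrow> 'a::euclidean_space set \<Rightarrow> ('a \<Rightarrow> real) set" where
  "Lp_space r S = {f \<in> borel_measurable (lebesgue_on S).
      integrable (lebesgue_on S) (\<lambda>x. \<bar>f x\<bar> powr r)}"

text \<open>Only meaningful for members of \<^const>\<open>Lp_space\<close>.\<close>

definition Lp_norm :: "real \<Rightarrow> 'a::euclidean_space set \<Rightarrow> ('a \<Rightarrow> real) \<Rightarrow> real" where
  "Lp_norm r S f = (\<integral>x. \<bar>f x\<bar> powr r \<partial>lebesgue_on S) powr (1 / r)"

text \<open>The supremum norm takes values in the extended half-line, for functions with values there.
  As \<^const>\<open>esssup\<close> is infinite on non-measurable functions, membership of \<open>F\<close> in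
  the Lebesgue space with exponent infinity on \<open>S\<close> is exactly \<open>Linf_norm S F < \<infinity>\<close>.
  On a null set \<open>S\<close> the norm is zero.\<close>

definition Linf_norm :: "'a::euclidean_space set \<Rightarrow> ('a \<Rightarrow> ennreal) \<Rightarrow> ennreal" where
  "Linf_norm S F = esssup (lebesgue_on S) F"

definition zero_ext :: "'a set \<Rightarrow> ('a \<Rightarrow> real) \<Rightarrow> 'a \<Rightarrow> real" where
  "zero_ext S u x = (if x \<in> S then u x else 0)"

definition closed_support :: "('a::topological_space \<Rightarrow> real) \<Rightarrow> 'a set" where
  "closed_support f = closure (support_on UNIV f)"

definition nonlocal_laplacian ::
    "('a::euclidean_space \<Rightarrow> 'a \<Rightarrow> real) \<Rightarrow> ('a \<Rightarrow> real) \<Rightarrow> 'a \<Rightarrow> real" where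
  "nonlocal_laplacian \<mu> u x = (\<integral>y. (u y - u x) * \<mu> x y \<partial>lebesgue)"

text \<open>The slice norms are \<open>[0,\<infinity>]\<close>-valued, so that a reciprocal \<open>1 / lambda_ker \<mu> x\<close> is
  infinite, rather than zero, where \<open>lambda_ker \<mu> x\<close> vanishes.\<close>

definition gamma_ker :: "('a::euclidean_space \<Rightarrow> 'a \<Rightarrow> real) \<Rightarrow> 'a \<Rightarrow> ennreal" where
  "gamma_ker \<mu> y = (\<integral>\<^sup>+ x. ennreal \<bar>\<mu> x y\<bar> \<partial>lebesgue)"

definition lambda_ker :: "('a::euclidean_space \<Rightarrow> 'a \<Rightarrow> real) \<Rightarrow> 'a \<Rightarrow> ennreal" where
  "lambda_ker \<mu> x = (\<integral>\<^sup>+ y. ennreal \<bar>\<mu> x y\<bar> \<partial>lebesgue)"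

definition M_const :: "('a::euclidean_space \<Rightarrow> 'a \<Rightarrow> real) \<Rightarrow> real \<Rightarrow> real" where
  "M_const \<mu> r = enn2real (Linf_norm UNIV (gamma_ker \<mu>)) powr (1 / r)
      * enn2real (Linf_norm UNIV (lambda_ker \<mu>)) powr (1 - 1 / r)"

text \<open>Functions in Lebesgue spaces are determined up to null sets, so both equations are imposed
  almost everywhere. The function \<open>u\<close> matters only on \<open>\<Omega> \<union> \<Gamma>\<close>.\<close>

definition solves_nonlocal_dirichlet ::
    "('a::euclidean_space \<Rightarrow> 'a \<Rightarrow> real) \<Rightarrow> 'a set \<Rightarrow> 'a set
      \<Rightarrow> ('a \<Rightarrow> real) \<Rightarrow> ('a \<Rightarrow> real) \<Rightarrow> ('a \<Rightarrow> real) \<Rightarrow> bool" where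
  "solves_nonlocal_dirichlet \<mu> \<Omega> \<Gamma> f g u \<longleftrightarrow>
     (AE x in lebesgue. x \<in> \<Omega> \<longrightarrow> nonlocal_laplacian \<mu> (zero_ext (\<Omega> \<union> \<Gamma>) u) x = f x) \<and>
     (AE x in lebesgue. x \<in> \<Gamma> \<longrightarrow> u x = g x)"

end

theory Submission
  imports Defs
begin

text \<open>The difference \<open>w = u2 - u1\<close>, extended by zero, vanishes almost everywhere off \<open>\<Omega>\<close>,
  because both solutions equal \<open>g\<close> on the collar. For almost every \<open>x \<in> \<Omega>\<close> the integral
  defining the operator can be split, and subtracting the two equations gives
  \<open>lambda(x) * w(x) = T w x - (f2 - f1)(x)\<close>, where \<open>T w x = \<integral>w(y) * \<mu>(x, y) dy\<close>
  and \<open>lambda(x) = \<integral>\<mu>(x, y) dy\<close>. Division by \<open>lambda(x)\<close> costs at most the factor \<open>K\<close>.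

  The heart of the matter is that the integral operator \<open>T\<close> is bounded on \<open>L^r\<close> with norm at most
  \<open>M_const \<mu> r\<close>. This is the Schur test \<open>schur_test\<close>: by Jensen's inequality for the measure
  \<open>\<mu>(x, y) dy\<close> (\<open>jensen_weighted\<close>), \<open>\<bar>T w x\<bar>^r\<close> is at most the row mass to the power
  \<open>r - 1\<close> times \<open>\<integral>\<bar>w(y)\<bar>^r * \<mu>(x, y) dy\<close>; integrating in \<open>x\<close> and interchanging the
  integrals leaves the column mass \<open>\<integral>\<mu>(x, y) dx\<close> as a weight.
  The same estimate shows that the splitting of the integral is legitimate.

  The triangle inequality in \<open>L^r(\<Omega>)\<close> then yields
  \<open>\<parallel>w\<parallel> \<le> K * M_const \<mu> r * \<parallel>w\<parallel> + K * \<parallel>f2 - f1\<parallel>\<close>,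
  where the norm of \<open>w\<close> over the whole space has become the norm over \<open>\<Omega>\<close>. All
  terms are finite and \<open>K * M_const \<mu> r < 1\<close>, so the first term on the right can be absorbed
  into the left-hand side.\<close>

section \<open>Convexity of powers, Jensen and Minkowski inequalities\<close>

text \<open>The graph of a convex function lies above its tangents. Convexity of \<open>powr\<close> is used on the
  open half-line, so that the point \<open>t = 0\<close> is a case of its own.\<close>

lemma powr_ge_tangent:
  fixes t m r :: real
  assumes "t \<ge> 0" "m > 0" "r \<ge> 1"
  shows "m powr r + r * m powr (r - 1) * (t - m) \<le> t powr r"
proof (cases "t = 0")
  case True
  have "m powr (r - 1) * m = m powr r"
    using assms by (simp add: powr_diff)
  hence "m powr r + r * m powr (r - 1) * (0 - m) = (1 - r) * m powr r"
    by (simp add: algebra_simps)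
  also have "\<dots> \<le> 0" using assms by (simp add: mult_nonpos_nonneg)
  finally show ?thesis using True assms by simp
next
  case False
  have "t powr r - m powr r \<ge> r * m powr (r - 1) * (t - m)"
  proof (rule convex_on_imp_above_tangent[where A = "{0<..}"])
    show "((\<lambda>x. x powr r) has_real_derivative r * m powr (r - 1)) (at m within {0<..})"
      using assms by (auto intro!: derivative_eq_intros)
  qed (use assms False in \<open>auto simp: powr_convex interior_open\<close>)
  thus ?thesis by simp
qed

lemma powr_convex_combination_le:
  fixes p q \<theta> r :: real
  assumes "p \<ge> 0" "q \<ge> 0" "0 \<le> \<theta>" "\<theta> \<le> 1" "r \<ge> 1"
  shows "(\<theta> * p + (1 - \<theta>) * q) powr r \<le> \<theta> * p powr r + (1 - \<theta>) * q powr r"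
proof (cases "\<theta> * p + (1 - \<theta>) * q = 0")
  case True
  thus ?thesis using assms by simp
next
  case False
  define m where "m = \<theta> * p + (1 - \<theta>) * q"
  have m: "m > 0" using False assms unfolding m_def
    by (metis add_nonneg_nonneg diff_ge_0_iff_ge less_eq_real_def mult_nonneg_nonneg)
  define s where "s = r * m powr (r - 1)"
  have "\<theta> * (m powr r + s * (p - m)) + (1 - \<theta>) * (m powr r + s * (q - m))
      \<le> \<theta> * p powr r + (1 - \<theta>) * q powr r"
    unfolding s_def using assms m
    by (intro add_mono mult_left_mono powr_ge_tangent) auto
  moreover have "\<theta> * (m powr r + s * (p - m)) + (1 - \<theta>) * (m powr r + s * (q - m))
      = m powr r + s * (\<theta> * p + (1 - \<theta>) * q - m)"
    by (simp add: algebra_simps)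
  ultimately show ?thesis by (simp add: m_def)
qed

text \<open>With \<open>l\<close> the mass of the weight \<open>k\<close> and \<open>m\<close> the \<open>k\<close>-mean of \<open>\<bar>v\<bar>\<close>, integrating the
  tangent inequality at \<open>m\<close> against \<open>k\<close> gives \<open>m powr r * l \<le> \<integral>\<bar>v\<bar> powr r * k\<close>,
  since the linear term has mean zero. Multiplying by \<open>l powr (r - 1)\<close> turns the mean back into the
  integral. This normalisation leaves the case \<open>r = 1\<close>, \<open>\<Lambda> = 0\<close> correct: the right-hand side is
  then zero because \<open>0 powr 0 = 0\<close>, but the weight vanishes almost everywhere.\<close>

lemma jensen_weighted:
  fixes v k :: "'a \<Rightarrow> real"
  assumes r: "r \<ge> 1" and k0: "\<And>y. k y \<ge> 0"
    and ik: "integrable M k" and iv: "integrable M (\<lambda>y. \<bar>v y\<bar> * k y)"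
    and ir: "integrable M (\<lambda>y. \<bar>v y\<bar> powr r * k y)"
    and L: "(\<integral>y. k y \<partial>M) \<le> \<Lambda>"
  shows "\<bar>\<integral>y. v y * k y \<partial>M\<bar> powr r \<le> \<Lambda> powr (r - 1) * (\<integral>y. \<bar>v y\<bar> powr r * k y \<partial>M)"
proof -
  define l where "l = (\<integral>y. k y \<partial>M)"
  define A where "A = (\<integral>y. \<bar>v y\<bar> * k y \<partial>M)"
  define B where "B = (\<integral>y. \<bar>v y\<bar> powr r * k y \<partial>M)"
  have l0: "l \<ge> 0" and A0: "A \<ge> 0" and B0: "B \<ge> 0"
    unfolding l_def A_def B_def using k0 by simp_all
  have "\<bar>\<integral>y. v y * k y \<partial>M\<bar> \<le> A"
    unfolding A_def using integral_abs_bound[of M "\<lambda>y. v y * k y"] k0 by (simp add: abs_mult)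
  hence 1: "\<bar>\<integral>y. v y * k y \<partial>M\<bar> powr r \<le> A powr r" using r by (intro powr_mono2) auto
  have 2: "A powr r \<le> l powr (r - 1) * B"
  proof (cases "A = 0")
    case True thus ?thesis using B0 by simp
  next
    case False
    have "l \<noteq> 0"
    proof
      assume "l = 0"
      hence "AE y in M. k y = 0"
        unfolding l_def using integral_nonneg_eq_0_iff_AE[OF ik] k0 by simp
      hence "A = 0" unfolding A_def by (intro integral_eq_zero_AE) auto
      with False show False by simp
    qed
    hence lp: "l > 0" using l0 by simp
    define m where "m = A / l"
    have m: "m > 0" using False A0 lp by (simp add: m_def)
    define s where "s = r * m powr (r - 1)"
    have "(\<integral>y. (m powr r - s * m) * k y + s * (\<bar>v y\<bar> * k y) \<partial>M) \<le> B"
      unfolding B_def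
    proof (rule integral_mono[OF _ ir])
      show "integrable M (\<lambda>y. (m powr r - s * m) * k y + s * (\<bar>v y\<bar> * k y))"
        using ik iv by auto
      fix y
      have "(m powr r + s * (\<bar>v y\<bar> - m)) * k y \<le> \<bar>v y\<bar> powr r * k y"
        unfolding s_def using r m k0 by (intro mult_right_mono powr_ge_tangent) auto
      thus "(m powr r - s * m) * k y + s * (\<bar>v y\<bar> * k y) \<le> \<bar>v y\<bar> powr r * k y"
        by (simp add: algebra_simps)
    qed
    also have "(\<integral>y. (m powr r - s * m) * k y + s * (\<bar>v y\<bar> * k y) \<partial>M) = (m powr r - s * m) * l + s * A"
      unfolding l_def A_def using ik iv by simp
    also have "\<dots> = m powr r * l" using lp by (simp add: m_def algebra_simps)
    finally have "m powr r * l \<le> B" .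
    hence "l powr (r - 1) * (m powr r * l) \<le> l powr (r - 1) * B"
      by (intro mult_left_mono) auto
    moreover have "l powr (r - 1) * (m powr r * l) = A powr r"
      using lp A0 by (simp add: m_def powr_divide powr_diff)
    ultimately show ?thesis by simp
  qed
  have "l powr (r - 1) * B \<le> \<Lambda> powr (r - 1) * B"
    using l0 B0 L r unfolding l_def[symmetric] by (intro mult_right_mono powr_mono2) auto
  with 1 2 show ?thesis unfolding B_def by linarith
qed

text \<open>Write \<open>A\<close> and \<open>B\<close> for numbers slightly larger than the norms of \<open>p\<close> and \<open>q\<close>, and \<open>D = A + B\<close>.
  Then \<open>\<bar>p\<bar> + \<bar>q\<bar>\<close> is the convex combination, with weights \<open>A / D\<close> and \<open>B / D\<close>, of the
  functions \<open>\<bar>p\<bar> * D / A\<close> and \<open>\<bar>q\<bar> * D / B\<close>, whose norms are at most \<open>D\<close>. Enlarging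
  the norms by \<open>e / 2\<close> avoids division by zero.\<close>

lemma minkowski_dominated:
  fixes p q w :: "'a \<Rightarrow> real"
  assumes r: "r \<ge> 1"
    and ip: "integrable M (\<lambda>x. \<bar>p x\<bar> powr r)" and iq: "integrable M (\<lambda>x. \<bar>q x\<bar> powr r)"
    and iw: "integrable M (\<lambda>x. \<bar>w x\<bar> powr r)"
    and le: "AE x in M. \<bar>w x\<bar> \<le> \<bar>p x\<bar> + \<bar>q x\<bar>"
  shows "(\<integral>x. \<bar>w x\<bar> powr r \<partial>M) powr (1 / r)
      \<le> (\<integral>x. \<bar>p x\<bar> powr r \<partial>M) powr (1 / r) + (\<integral>x. \<bar>q x\<bar> powr r \<partial>M) powr (1 / r)"
    (is "?W \<le> ?P + ?Q")
proof (rule field_le_epsilon)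
  fix e :: real assume e: "e > 0"
  define A where "A = ?P + e / 2"
  define B where "B = ?Q + e / 2"
  define D where "D = A + B"
  have "A > 0" "B > 0"
    unfolding A_def B_def using e by (intro add_nonneg_pos; simp)+
  hence pos: "A > 0" "B > 0" "D > 0" by (simp_all add: D_def)
  have PA: "(\<integral>x. \<bar>p x\<bar> powr r \<partial>M) \<le> A powr r"
  proof -
    have "(\<integral>x. \<bar>p x\<bar> powr r \<partial>M) = ?P powr r" using r by (simp add: powr_powr)
    also have "\<dots> \<le> A powr r" using r e by (intro powr_mono2) (auto simp: A_def)
    finally show ?thesis .
  qed
  have QB: "(\<integral>x. \<bar>q x\<bar> powr r \<partial>M) \<le> B powr r"
  proof -
    have "(\<integral>x. \<bar>q x\<bar> powr r \<partial>M) = ?Q powr r" using r by (simp add: powr_powr)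
    also have "\<dots> \<le> B powr r" using r e by (intro powr_mono2) (auto simp: B_def)
    finally show ?thesis .
  qed
  define a where "a = A / D * (D / A) powr r"
  define b where "b = B / D * (D / B) powr r"
  have ab: "a \<ge> 0" "b \<ge> 0" using pos by (auto simp: a_def b_def)
  have pw: "\<bar>w x\<bar> powr r \<le> a * \<bar>p x\<bar> powr r + b * \<bar>q x\<bar> powr r"
    if "\<bar>w x\<bar> \<le> \<bar>p x\<bar> + \<bar>q x\<bar>" for x
  proof -
    have "\<bar>w x\<bar> powr r \<le> (\<bar>p x\<bar> + \<bar>q x\<bar>) powr r"
      using that r by (intro powr_mono2) auto
    also have "\<bar>p x\<bar> + \<bar>q x\<bar> = A / D * (D / A * \<bar>p x\<bar>) + (1 - A / D) * (D / B * \<bar>q x\<bar>)"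
    proof -
      have "1 - A / D = B / D" using pos by (simp add: D_def field_simps)
      thus ?thesis using pos by simp
    qed
    also have "\<dots> powr r \<le> A / D * (D / A * \<bar>p x\<bar>) powr r + (1 - A / D) * (D / B * \<bar>q x\<bar>) powr r"
      using pos r by (intro powr_convex_combination_le) (auto simp: D_def field_simps)
    also have "1 - A / D = B / D" using pos by (simp add: D_def field_simps)
    finally show ?thesis by (simp only: a_def b_def powr_mult mult.assoc)
  qed
  have "(\<integral>x. \<bar>w x\<bar> powr r \<partial>M) \<le> (\<integral>x. a * \<bar>p x\<bar> powr r + b * \<bar>q x\<bar> powr r \<partial>M)"
    using ip iq iw le by (intro integral_mono_AE) (auto elim!: eventually_mono intro!: pw)
  also have "\<dots> = a * (\<integral>x. \<bar>p x\<bar> powr r \<partial>M) + b * (\<integral>x. \<bar>q x\<bar> powr r \<partial>M)"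
    using ip iq by simp
  also have "\<dots> \<le> a * A powr r + b * B powr r"
    using ab PA QB by (intro add_mono mult_left_mono) auto
  also have "a * A powr r = A / D * D powr r"
    using pos by (simp add: a_def powr_divide)
  also have "b * B powr r = B / D * D powr r"
    using pos by (simp add: b_def powr_divide)
  also have "A / D * D powr r + B / D * D powr r = D powr r"
    using pos by (simp add: D_def flip: distrib_right add_divide_distrib)
  finally have "?W \<le> (D powr r) powr (1 / r)"
    using r by (intro powr_mono2) auto
  also have "\<dots> = D" using r pos by (simp add: powr_powr)
  finally show "?W \<le> ?P + ?Q + e" by (simp add: D_def A_def B_def)
qed

section \<open>The Schur test\<close>

text \<open>The rows and the columns of the kernel have mass at most \<open>\<Lambda>\<close> and \<open>G\<close>. The auxiliary function
  \<open>H x = \<integral>\<bar>v y\<bar> powr r * k (x, y) dy\<close> has integral at most \<open>G * \<integral>\<bar>v\<bar> powr r\<close> by Tonelli's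
  theorem. It is therefore finite for almost every \<open>x\<close>, which makes the row integrals in \<open>T\<close>
  converge, and by Jensen's inequality it dominates \<open>\<bar>T x\<bar> powr r\<close> up to
  the factor \<open>\<Lambda> powr (r - 1)\<close>.\<close>

lemma (in pair_sigma_finite) schur_test:
  fixes k :: "'a \<times> 'b \<Rightarrow> real" and v :: "'b \<Rightarrow> real"
  assumes r: "r \<ge> 1"
    and k [measurable]: "k \<in> borel_measurable (M1 \<Otimes>\<^sub>M M2)" and k0: "\<And>z. k z \<ge> 0"
    and v [measurable]: "v \<in> borel_measurable M2" and iv: "integrable M2 (\<lambda>y. \<bar>v y\<bar> powr r)"
    and L0: "\<Lambda> \<ge> 0" and L: "AE x in M1. (\<integral>\<^sup>+ y. ennreal (k (x, y)) \<partial>M2) \<le> ennreal \<Lambda>"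
    and G0: "G \<ge> 0" and G: "AE y in M2. (\<integral>\<^sup>+ x. ennreal (k (x, y)) \<partial>M1) \<le> ennreal G"
  defines "T \<equiv> \<lambda>x. \<integral>y. v y * k (x, y) \<partial>M2"
  shows "AE x in M1. integrable M2 (\<lambda>y. v y * k (x, y))"
    and "T \<in> borel_measurable M1"
    and "integrable M1 (\<lambda>x. \<bar>T x\<bar> powr r)"
    and "(\<integral>x. \<bar>T x\<bar> powr r \<partial>M1) \<le> \<Lambda> powr (r - 1) * (G * (\<integral>y. \<bar>v y\<bar> powr r \<partial>M2))"
proof -
  show T [measurable]: "T \<in> borel_measurable M1" unfolding T_def by measurable
  define N where "N = (\<integral>y. \<bar>v y\<bar> powr r \<partial>M2)"
  have N0: "N \<ge> 0" by (simp add: N_def)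
  define H where "H = (\<lambda>x. \<integral>\<^sup>+ y. ennreal (\<bar>v y\<bar> powr r * k (x, y)) \<partial>M2)"
  have H [measurable]: "H \<in> borel_measurable M1" unfolding H_def by measurable
  have "(\<integral>\<^sup>+ x. H x \<partial>M1)
      = (\<integral>\<^sup>+ y. (\<integral>\<^sup>+ x. ennreal (\<bar>v y\<bar> powr r * k (x, y)) \<partial>M1) \<partial>M2)"
    unfolding H_def by (rule Fubini'[symmetric]) measurable
  also have "\<dots> = (\<integral>\<^sup>+ y. ennreal (\<bar>v y\<bar> powr r) * (\<integral>\<^sup>+ x. ennreal (k (x, y)) \<partial>M1) \<partial>M2)"
    by (intro nn_integral_cong) (simp add: ennreal_mult k0 nn_integral_cmult)
  also have "\<dots> \<le> (\<integral>\<^sup>+ y. ennreal (\<bar>v y\<bar> powr r) * ennreal G \<partial>M2)"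
    using G by (intro nn_integral_mono_AE) (auto elim!: eventually_mono intro!: mult_left_mono)
  also have "\<dots> = ennreal N * ennreal G"
    using iv by (simp add: nn_integral_multc nn_integral_eq_integral N_def)
  finally have HG: "(\<integral>\<^sup>+ x. H x \<partial>M1) \<le> ennreal (G * N)"
    using G0 N0 by (simp add: ennreal_mult mult.commute)
  have Hfin: "AE x in M1. H x \<noteq> \<infinity>"
    using HG by (intro nn_integral_noteq_infinite) (auto simp: top_unique)
  have slice: "AE x in M1. integrable M2 (\<lambda>y. v y * k (x, y)) \<and>
      ennreal (\<bar>T x\<bar> powr r) \<le> ennreal (\<Lambda> powr (r - 1)) * H x"
    using Hfin L AE_space
  proof eventually_elim
    case (elim x)
    have ik: "integrable M2 (\<lambda>y. k (x, y))"
      using elim k0 by (intro integrableI_nonneg) (auto simp: less_top[symmetric] top_unique)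
    have ir: "integrable M2 (\<lambda>y. \<bar>v y\<bar> powr r * k (x, y))"
      using elim k0 by (intro integrableI_nonneg) (auto simp: less_top[symmetric] H_def)
    \<comment> \<open>The row has finite mass, so \<open>\<bar>v\<bar> \<le> 1 + \<bar>v\<bar> powr r\<close> reduces this to the power \<open>r\<close>.\<close>
    have i1: "integrable M2 (\<lambda>y. v y * k (x, y))"
    proof (rule Bochner_Integration.integrable_bound[OF Bochner_Integration.integrable_add[OF ik ir]])
      show "AE y in M2. norm (v y * k (x, y)) \<le> norm (k (x, y) + \<bar>v y\<bar> powr r * k (x, y))"
      proof (intro AE_I2)
        fix y
        have "\<bar>v y\<bar> \<le> 1 + \<bar>v y\<bar> powr r"
        proof (cases "\<bar>v y\<bar> \<le> 1")
          case False
          hence "\<bar>v y\<bar> powr 1 \<le> \<bar>v y\<bar> powr r" using r by (intro powr_mono) auto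
          thus ?thesis using False by simp
        qed (simp add: add_increasing2)
        hence "\<bar>v y\<bar> * k (x, y) \<le> (1 + \<bar>v y\<bar> powr r) * k (x, y)"
          using k0 by (intro mult_right_mono)
        thus "norm (v y * k (x, y)) \<le> norm (k (x, y) + \<bar>v y\<bar> powr r * k (x, y))"
          using k0[of "(x, y)"] by (simp add: abs_mult algebra_simps)
      qed
    qed (use elim in measurable)
    have iabs: "integrable M2 (\<lambda>y. \<bar>v y\<bar> * k (x, y))"
      using integrable_abs[OF i1] k0 by (simp add: abs_mult)
    have "ennreal (\<integral>y. k (x, y) \<partial>M2) \<le> ennreal \<Lambda>"
      using elim k0 nn_integral_eq_integral[OF ik] by simp
    hence "(\<integral>y. k (x, y) \<partial>M2) \<le> \<Lambda>" using L0 by (simp add: ennreal_le_iff)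
    hence "\<bar>T x\<bar> powr r \<le> \<Lambda> powr (r - 1) * (\<integral>y. \<bar>v y\<bar> powr r * k (x, y) \<partial>M2)"
      unfolding T_def by (intro jensen_weighted r k0 ik iabs ir)
    moreover have "H x = ennreal (\<integral>y. \<bar>v y\<bar> powr r * k (x, y) \<partial>M2)"
      unfolding H_def using ir k0 by (intro nn_integral_eq_integral) auto
    ultimately have "ennreal (\<bar>T x\<bar> powr r) \<le> ennreal (\<Lambda> powr (r - 1)) * H x"
      using k0 by (simp add: ennreal_mult[symmetric] ennreal_leI)
    with i1 show ?case by simp
  qed
  thus "AE x in M1. integrable M2 (\<lambda>y. v y * k (x, y))" by eventually_elim simp
  have "(\<integral>\<^sup>+ x. ennreal (\<bar>T x\<bar> powr r) \<partial>M1) \<le> (\<integral>\<^sup>+ x. ennreal (\<Lambda> powr (r - 1)) * H x \<partial>M1)"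
    using slice by (intro nn_integral_mono_AE) (auto elim: eventually_mono)
  also have "\<dots> = ennreal (\<Lambda> powr (r - 1)) * (\<integral>\<^sup>+ x. H x \<partial>M1)"
    by (simp add: nn_integral_cmult)
  also have "\<dots> \<le> ennreal (\<Lambda> powr (r - 1)) * ennreal (G * N)"
    by (intro mult_left_mono HG) auto
  also have "\<dots> = ennreal (\<Lambda> powr (r - 1) * (G * N))"
    using G0 N0 by (simp add: ennreal_mult)
  finally have bd: "(\<integral>\<^sup>+ x. ennreal (\<bar>T x\<bar> powr r) \<partial>M1) \<le> ennreal (\<Lambda> powr (r - 1) * (G * N))" .
  show iT: "integrable M1 (\<lambda>x. \<bar>T x\<bar> powr r)"
    using bd by (intro integrableI_nonneg) (auto intro: le_less_trans)
  show "(\<integral>x. \<bar>T x\<bar> powr r \<partial>M1) \<le> \<Lambda> powr (r - 1) * (G * (\<integral>y. \<bar>v y\<bar> powr r \<partial>M2))"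
    using bd G0 N0 unfolding N_def[symmetric]
    by (subst (asm) nn_integral_eq_integral[OF iT]) (auto simp: ennreal_le_iff)
qed

section \<open>From Borel to Lebesgue measurable functions\<close>

text \<open>Fubini's theorem concerns product measures, but the product of two Lebesgue measures is not
  complete. Lebesgue measurable functions are therefore replaced by almost everywhere equal Borel
  functions; this and the following lemmas carry the conclusions back.\<close>

lemma borel_measurable_completion_AE_cong:
  fixes f g :: "'a \<Rightarrow> 'b::topological_space"
  assumes g: "g \<in> borel_measurable M" and eq: "AE x in M. f x = g x"
  shows "f \<in> borel_measurable (completion M)"
proof (rule measurableI)
  fix A :: "'b set" assume A: "A \<in> sets borel"
  have sets: "g -` A \<inter> space M \<in> sets (completion M)"
    using measurable_sets[OF g A] by simp
  have "AE x in completion M. x \<in> g -` A \<inter> space M \<longleftrightarrow> x \<in> f -` A \<inter> space M"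
    using eq by (intro AE_completion) (auto elim: eventually_mono)
  from completion.in_sets_AE[OF this sets]
  show "f -` A \<inter> space (completion M) \<in> sets (completion M)" by simp
qed simp

lemma integrable_completion_AE_cong:
  fixes f g :: "'a \<Rightarrow> real"
  assumes g: "g \<in> borel_measurable M" and eq: "AE x in M. f x = g x"
  shows "integrable (completion M) f \<longleftrightarrow> integrable M g"
    and "integral\<^sup>L (completion M) f = integral\<^sup>L M g"
proof -
  have f: "f \<in> borel_measurable (completion M)"
    by (rule borel_measurable_completion_AE_cong[OF g eq])
  have "integrable (completion M) f \<longleftrightarrow> integrable (completion M) g"
    using f g eq by (intro integrable_cong_AE) (auto intro: AE_completion measurable_completion)
  thus "integrable (completion M) f \<longleftrightarrow> integrable M g" by (simp add: integrable_completion g)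
  have "integral\<^sup>L (completion M) f = integral\<^sup>L (completion M) g"
    using f g eq by (intro integral_cong_AE) (auto intro: AE_completion measurable_completion)
  thus "integral\<^sup>L (completion M) f = integral\<^sup>L M g" by (simp add: integral_completion g)
qed

text \<open>The predicate need not be measurable, so for the second claim it is replaced by the complement of
  a measurable null set before the order of the two quantifiers is exchanged.\<close>

lemma AE_lborel_prod_slices:
  fixes P :: "'a::euclidean_space \<times> 'b::euclidean_space \<Rightarrow> bool"
  assumes "AE z in lborel. P z"
  shows "AE x in lborel. AE y in lborel. P (x, y)" and "AE y in lborel. AE x in lborel. P (x, y)"
proof -
  have P: "AE z in lborel \<Otimes>\<^sub>M lborel. P z" using assms unfolding lborel_prod .
  then obtain N where N: "N \<in> null_sets (lborel \<Otimes>\<^sub>M lborel)" "{z. \<not> P z} \<subseteq> N"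
    by (auto elim!: AE_E simp: space_pair_measure null_sets_def)
  show 1: "AE x in lborel. AE y in lborel. P (x, y)"
    using lborel_pair.AE_pair[OF P] .
  have "AE x in lborel. AE y in lborel. (x, y) \<notin> N"
    using lborel_pair.AE_pair[OF AE_not_in[OF N(1)]] .
  moreover have "{z \<in> space (lborel \<Otimes>\<^sub>M lborel). (fst z, snd z) \<notin> N} = space (lborel \<Otimes>\<^sub>M lborel) - N"
    by auto
  hence "{z \<in> space (lborel \<Otimes>\<^sub>M lborel). (fst z, snd z) \<notin> N} \<in> sets (lborel \<Otimes>\<^sub>M lborel)"
    using N(1) by (simp only: sets.compl_sets null_setsD2)
  ultimately have "AE y in lborel. AE x in lborel. (x, y) \<notin> N"
    by (simp only: lborel_pair.AE_commute)
  thus "AE y in lborel. AE x in lborel. P (x, y)"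
    using N(2) by (auto elim!: eventually_mono)
qed

section \<open>Lebesgue spaces\<close>

lemma Lp_spaceD:
  assumes "f \<in> Lp_space r S"
  shows "f \<in> borel_measurable (lebesgue_on S)" "integrable (lebesgue_on S) (\<lambda>x. \<bar>f x\<bar> powr r)"
  using assms by (auto simp: Lp_space_def)

lemma Lp_space_diff:
  assumes r: "r \<ge> 1" and f: "f \<in> Lp_space r S" and g: "g \<in> Lp_space r S"
  shows "(\<lambda>x. f x - g x) \<in> Lp_space r S"
proof -
  note [measurable] = Lp_spaceD(1)[OF f] Lp_spaceD(1)[OF g]
  have "integrable (lebesgue_on S) (\<lambda>x. \<bar>f x - g x\<bar> powr r)"
  proof (rule Bochner_Integration.integrable_bound)
    show "integrable (lebesgue_on S) (\<lambda>x. 2 powr r * (\<bar>f x\<bar> powr r + \<bar>g x\<bar> powr r))"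
      using Lp_spaceD(2)[OF f] Lp_spaceD(2)[OF g] by simp
    show "AE x in lebesgue_on S. norm (\<bar>f x - g x\<bar> powr r)
        \<le> norm (2 powr r * (\<bar>f x\<bar> powr r + \<bar>g x\<bar> powr r))"
    proof (intro AE_I2)
      fix x
      have "\<bar>f x - g x\<bar> powr r \<le> (2 * max \<bar>f x\<bar> \<bar>g x\<bar>) powr r"
        using r by (intro powr_mono2) auto
      also have "\<dots> = 2 powr r * max \<bar>f x\<bar> \<bar>g x\<bar> powr r" by (simp add: powr_mult)
      also have "\<dots> \<le> 2 powr r * (\<bar>f x\<bar> powr r + \<bar>g x\<bar> powr r)"
        by (intro mult_left_mono) (auto simp: max_def)
      finally show "norm (\<bar>f x - g x\<bar> powr r) \<le> norm (2 powr r * (\<bar>f x\<bar> powr r + \<bar>g x\<bar> powr r))"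
        by simp
    qed
  qed measurable
  thus ?thesis by (simp add: Lp_space_def)
qed

lemma zero_ext_in_Lp_space:
  fixes u :: "'a::euclidean_space \<Rightarrow> real"
  assumes S: "S \<in> sets lebesgue" and u: "u \<in> Lp_space r S"
  shows "zero_ext S u \<in> Lp_space r UNIV"
proof -
  have "zero_ext S u = (\<lambda>x. if x \<in> S then u x else 0)" by (auto simp: zero_ext_def)
  moreover have "(\<lambda>x. \<bar>zero_ext S u x\<bar> powr r) = (\<lambda>x. if x \<in> S then \<bar>u x\<bar> powr r else 0)"
    by (auto simp: zero_ext_def)
  ultimately show ?thesis
    using Lp_spaceD[OF u] S
    by (simp add: Lp_space_def lebesgue_on_UNIV_eq borel_measurable_if Lebesgue_Measure.integrable_restrict_UNIV)
qed

lemma Lp_norm_mono_set: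
  assumes S: "S \<in> sets lebesgue" and r: "r \<ge> 1" and f: "f \<in> Lp_space r UNIV"
  shows "f \<in> Lp_space r S" and "Lp_norm r S f \<le> Lp_norm r UNIV f"
proof -
  note f' = Lp_spaceD[OF f, unfolded lebesgue_on_UNIV_eq]
  have i: "integrable (lebesgue_on S) (\<lambda>x. \<bar>f x\<bar> powr r)"
    using integrable_mult_indicator[OF S f'(2)] S by (simp add: integrable_restrict_space)
  moreover have "f \<in> borel_measurable (lebesgue_on S)"
    using f'(1) by (rule measurable_restrict_space1)
  ultimately show "f \<in> Lp_space r S" by (simp add: Lp_space_def)
  have "(\<integral>x. \<bar>f x\<bar> powr r \<partial>lebesgue_on S) \<le> (\<integral>x. \<bar>f x\<bar> powr r \<partial>lebesgue_on UNIV)"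
    using f'(2) S by (intro integral_mono_lebesgue_on_AE) (auto simp: lebesgue_on_UNIV_eq)
  thus "Lp_norm r S f \<le> Lp_norm r UNIV f"
    unfolding Lp_norm_def using r by (intro powr_mono2) auto
qed

lemma Lp_norm_eq_of_AE_zero_outside:
  assumes S: "S \<in> sets lebesgue" and f: "f \<in> borel_measurable lebesgue"
    and 0: "AE x in lebesgue. x \<notin> S \<longrightarrow> f x = 0"
  shows "Lp_norm r UNIV f = Lp_norm r S f"
proof -
  have "(\<integral>x. \<bar>f x\<bar> powr r \<partial>lebesgue) = (\<integral>x. indicator S x *\<^sub>R \<bar>f x\<bar> powr r \<partial>lebesgue)"
    using 0 f S by (intro integral_cong_AE) (auto elim!: eventually_mono simp: indicator_def)
  thus ?thesis using S by (simp add: Lp_norm_def integral_restrict_space lebesgue_on_UNIV_eq)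
qed

lemma Lp_norm_cmult:
  assumes "c \<ge> 0" "r \<ge> 1"
  shows "Lp_norm r S (\<lambda>x. c * f x) = c * Lp_norm r S f"
  using assms by (simp add: Lp_norm_def abs_mult powr_mult powr_powr)

lemma Lp_space_cmult:
  assumes "c \<ge> 0" and f: "f \<in> Lp_space r S"
  shows "(\<lambda>x. c * f x) \<in> Lp_space r S"
  using assms Lp_spaceD[OF f] by (simp add: Lp_space_def abs_mult powr_mult)

section \<open>The nonlocal operator\<close>

text \<open>Here \<open>schur_test\<close> is applied to Borel versions \<open>w\<close> and \<open>k\<close> of \<open>v\<close> and \<open>\<mu>\<close>.
  The two factors of \<open>M_const\<close> are the column bound to the power \<open>1 / r\<close> and the row bound
  to the power \<open>(r - 1) / r\<close>.\<close>

lemma nonlocal_schur_test: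
  fixes \<mu> :: "'a::euclidean_space \<Rightarrow> 'a \<Rightarrow> real" and v :: "'a \<Rightarrow> real"
  assumes r: "r \<ge> 1" and \<mu>0: "\<And>x y. \<mu> x y \<ge> 0"
    and \<mu>: "(\<lambda>(x, y). \<mu> x y) \<in> borel_measurable lebesgue"
    and G: "Linf_norm UNIV (gamma_ker \<mu>) < \<infinity>" and L: "Linf_norm UNIV (lambda_ker \<mu>) < \<infinity>"
    and v: "v \<in> Lp_space r UNIV"
  defines "T \<equiv> \<lambda>x. \<integral>y. v y * \<mu> x y \<partial>lebesgue"
  shows "AE x in lebesgue. integrable lebesgue (\<lambda>y. v y * \<mu> x y)"
    and "T \<in> Lp_space r UNIV"
    and "Lp_norm r UNIV T \<le> M_const \<mu> r * Lp_norm r UNIV v"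
proof -
  have v_meas: "v \<in> borel_measurable lebesgue" and v_int: "integrable lebesgue (\<lambda>y. \<bar>v y\<bar> powr r)"
    using Lp_spaceD[OF v] by (simp_all add: lebesgue_on_UNIV_eq)
  obtain m where m: "m \<in> borel_measurable lborel" and m_eq: "AE z in lborel. (case z of (x, y) \<Rightarrow> \<mu> x y) = m z"
    using completion_ex_borel_measurable_real[OF \<mu>] by auto
  \<comment> \<open>The Borel version of the kernel may be negative on a null set; its positive part is not.\<close>
  define k where "k = (\<lambda>z. max 0 (m z))"
  have k [measurable]: "k \<in> borel_measurable (lborel \<Otimes>\<^sub>M lborel)"
    using m unfolding k_def by (simp add: lborel_prod)
  have k_eq: "AE z in lborel. (case z of (x, y) \<Rightarrow> \<mu> x y) = k z"
    using m_eq
  proof eventually_elim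
    case (elim z)
    thus ?case using \<mu>0[of "fst z" "snd z"] by (simp add: k_def case_prod_beta)
  qed
  note k1 = AE_lborel_prod_slices(1)[OF k_eq, simplified]
  note k2 = AE_lborel_prod_slices(2)[OF k_eq, simplified]
  obtain w where w [measurable]: "w \<in> borel_measurable lborel" and w_eq: "AE y in lborel. v y = w y"
    using completion_ex_borel_measurable_real[OF v_meas] by auto
  have ww: "AE y in lborel. \<bar>v y\<bar> powr r = \<bar>w y\<bar> powr r"
    using w_eq by eventually_elim simp
  have w_meas: "(\<lambda>y. \<bar>w y\<bar> powr r) \<in> borel_measurable lborel" by measurable
  have w_int: "integrable lborel (\<lambda>y. \<bar>w y\<bar> powr r)"
    using integrable_completion_AE_cong(1)[OF w_meas ww] v_int by simp
  define g where "g = enn2real (Linf_norm UNIV (gamma_ker \<mu>))"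
  define l where "l = enn2real (Linf_norm UNIV (lambda_ker \<mu>))"
  have g: "Linf_norm UNIV (gamma_ker \<mu>) = ennreal g" and l: "Linf_norm UNIV (lambda_ker \<mu>) = ennreal l"
    using G L unfolding g_def l_def by (auto simp: less_top)
  have gl0: "g \<ge> 0" "l \<ge> 0" by (simp_all add: g_def l_def)
  have "AE x in lborel. lambda_ker \<mu> x \<le> ennreal l"
    using esssup_AE[of "lambda_ker \<mu>" lebesgue] l
    by (simp add: Linf_norm_def lebesgue_on_UNIV_eq AE_completion_iff)
  hence lam: "AE x in lborel. (\<integral>\<^sup>+ y. ennreal (k (x, y)) \<partial>lborel) \<le> ennreal l"
    using k1
  proof eventually_elim
    case (elim x)
    have "lambda_ker \<mu> x = (\<integral>\<^sup>+ y. ennreal (k (x, y)) \<partial>lborel)"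
      unfolding lambda_ker_def nn_integral_completion
      using elim(2) \<mu>0 by (intro nn_integral_cong_AE) (auto elim!: eventually_mono)
    thus ?case using elim(1) by simp
  qed
  have "AE y in lborel. gamma_ker \<mu> y \<le> ennreal g"
    using esssup_AE[of "gamma_ker \<mu>" lebesgue] g
    by (simp add: Linf_norm_def lebesgue_on_UNIV_eq AE_completion_iff)
  hence gam: "AE y in lborel. (\<integral>\<^sup>+ x. ennreal (k (x, y)) \<partial>lborel) \<le> ennreal g"
    using k2
  proof eventually_elim
    case (elim y)
    have "gamma_ker \<mu> y = (\<integral>\<^sup>+ x. ennreal (k (x, y)) \<partial>lborel)"
      unfolding gamma_ker_def nn_integral_completion
      using elim(2) \<mu>0 by (intro nn_integral_cong_AE) (auto elim!: eventually_mono)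
    thus ?case using elim(1) by simp
  qed
  have k0: "k z \<ge> 0" for z by (simp add: k_def)
  note schur = lborel_pair.schur_test[OF r k k0 w w_int gl0(2) lam gl0(1) gam]
  define T' where "T' = (\<lambda>x. \<integral>y. w y * k (x, y) \<partial>lborel)"
  have T'_meas [measurable]: "T' \<in> borel_measurable lborel" using schur(2) by (simp add: T'_def)
  have slices: "AE x in lborel. (integrable lebesgue (\<lambda>y. v y * \<mu> x y)
      \<longleftrightarrow> integrable lborel (\<lambda>y. w y * k (x, y))) \<and> T x = T' x"
    using k1
  proof eventually_elim
    case (elim x)
    have "AE y in lborel. v y * \<mu> x y = w y * k (x, y)"
      using elim w_eq by eventually_elim simp
    moreover have "(\<lambda>y. w y * k (x, y)) \<in> borel_measurable lborel" by measurable
    ultimately show ?case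
      unfolding T_def T'_def by (simp add: integrable_completion_AE_cong)
  qed
  show "AE x in lebesgue. integrable lebesgue (\<lambda>y. v y * \<mu> x y)"
    unfolding AE_completion_iff using slices schur(1) by eventually_elim simp
  have T_eq: "AE x in lborel. T x = T' x" using slices by eventually_elim simp
  have T_meas: "T \<in> borel_measurable lebesgue"
    by (rule borel_measurable_completion_AE_cong[OF T'_meas T_eq])
  have TT: "AE x in lborel. \<bar>T x\<bar> powr r = \<bar>T' x\<bar> powr r" using T_eq by eventually_elim simp
  have TT_meas: "(\<lambda>x. \<bar>T' x\<bar> powr r) \<in> borel_measurable lborel" by measurable
  show "T \<in> Lp_space r UNIV"
    using T_meas schur(3) integrable_completion_AE_cong(1)[OF TT_meas TT]
    by (simp add: Lp_space_def lebesgue_on_UNIV_eq T'_def)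
  have "(\<integral>x. \<bar>T x\<bar> powr r \<partial>lebesgue) \<le> l powr (r - 1) * (g * (\<integral>y. \<bar>v y\<bar> powr r \<partial>lebesgue))"
    using schur(4) integrable_completion_AE_cong(2)[OF TT_meas TT]
      integrable_completion_AE_cong(2)[OF w_meas ww] by (simp add: T'_def)
  hence "Lp_norm r UNIV T
      \<le> (l powr (r - 1) * (g * (\<integral>y. \<bar>v y\<bar> powr r \<partial>lebesgue))) powr (1 / r)"
    unfolding Lp_norm_def lebesgue_on_UNIV_eq using r by (intro powr_mono2) auto
  also have "\<dots> = l powr ((r - 1) * (1 / r)) * (g powr (1 / r) * Lp_norm r UNIV v)"
    using gl0 by (simp add: powr_mult powr_powr Lp_norm_def lebesgue_on_UNIV_eq)
  also have "(r - 1) * (1 / r) = 1 - 1 / r" using r by (simp add: field_simps)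
  finally show "Lp_norm r UNIV T \<le> M_const \<mu> r * Lp_norm r UNIV v"
    by (simp add: M_const_def g_def l_def mult_ac)
qed

text \<open>Both integrability hypotheses matter: the integral of a non-integrable function is zero by
  convention, and would not be additive.\<close>

lemma nonlocal_laplacian_eq:
  assumes v: "integrable lebesgue (\<lambda>y. v y * \<mu> x y)" and \<mu>: "integrable lebesgue (\<mu> x)"
  shows "nonlocal_laplacian \<mu> v x = (\<integral>y. v y * \<mu> x y \<partial>lebesgue) - v x * (\<integral>y. \<mu> x y \<partial>lebesgue)"
  unfolding nonlocal_laplacian_def using assms by (simp add: left_diff_distrib)

text \<open>The value \<open>t\<close> stands for the integral operator at \<open>x\<close>. A finite bound on the extended reciprocal
  forces \<open>lambda_ker \<mu> x\<close> to be positive, since \<open>1 / 0\<close> is infinite there, so the equation can be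
  solved for \<open>w\<close>.\<close>

lemma abs_le_of_reciprocal_bound:
  assumes \<mu>0: "\<And>y. \<mu> x y \<ge> 0" and \<mu>: "integrable lebesgue (\<mu> x)"
    and K0: "K \<ge> 0" and K: "1 / lambda_ker \<mu> x \<le> ennreal K"
    and eq: "t - w * (\<integral>y. \<mu> x y \<partial>lebesgue) = f"
  shows "\<bar>w\<bar> \<le> K * (\<bar>t\<bar> + \<bar>f\<bar>)"
proof -
  define l where "l = (\<integral>y. \<mu> x y \<partial>lebesgue)"
  have l0: "l \<ge> 0" using \<mu>0 by (simp add: l_def)
  have lam: "lambda_ker \<mu> x = ennreal l"
    unfolding lambda_ker_def l_def using \<mu> \<mu>0 by (simp add: nn_integral_eq_integral)
  have l: "l > 0"
  proof (rule ccontr)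
    assume "\<not> l > 0"
    hence "l = 0" using l0 by simp
    with K lam show False by (simp add: top_unique)
  qed
  have "ennreal (1 / l) \<le> ennreal K"
    using K l by (simp add: lam divide_ennreal flip: ennreal_1)
  hence "1 / l \<le> K" using K0 by (simp add: ennreal_le_iff)
  moreover have "w = 1 / l * (t - f)" using eq l by (simp add: l_def[symmetric] field_simps)
  hence "\<bar>w\<bar> = 1 / l * \<bar>t - f\<bar>" using l by (simp add: abs_mult)
  ultimately have "\<bar>w\<bar> \<le> K * \<bar>t - f\<bar>" by (simp add: mult_right_mono del: times_divide_eq_left)
  also have "\<dots> \<le> K * (\<bar>t\<bar> + \<bar>f\<bar>)" using K0 by (intro mult_left_mono) auto
  finally show ?thesis .
qed

section \<open>The stability estimate\<close>

theorem theorem3p3: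
  fixes \<Omega> \<Gamma> :: "(real ^ 'n) set"
    and \<mu> :: "real ^ 'n \<Rightarrow> real ^ 'n \<Rightarrow> real"
    and f1 f2 g u1 u2 :: "real ^ 'n \<Rightarrow> real"
    and r K C2 :: real
  assumes "open \<Omega>" and "bounded \<Omega>"
    and "\<Gamma> \<in> sets lebesgue" and "\<Gamma> \<subseteq> - \<Omega>"
    and "r \<ge> 1"
    and "\<And>x y. \<mu> x y \<ge> 0"
    and "(\<lambda>(x, y). \<mu> x y) \<in> Lp_space 1 UNIV"
    and "(\<Union>x\<in>\<Omega>. closed_support (\<mu> x)) - \<Omega> \<subseteq> \<Gamma>"
    and "AE y in lebesgue. (\<lambda>x. \<mu> x y) \<in> Lp_space 1 UNIV"
    and "AE x in lebesgue. \<mu> x \<in> Lp_space 1 UNIV"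
    and "Linf_norm UNIV (gamma_ker \<mu>) < \<infinity>"
    and "Linf_norm UNIV (lambda_ker \<mu>) < \<infinity>"
    and "Linf_norm (\<Omega> \<union> \<Gamma>) (\<lambda>x. 1 / lambda_ker \<mu> x) < \<infinity>"
    and K_eq: "K = enn2real (Linf_norm (\<Omega> \<union> \<Gamma>) (\<lambda>x. 1 / lambda_ker \<mu> x))"
    and "1 - M_const \<mu> r * K > 0"
    and C2_eq: "C2 = K / (1 - M_const \<mu> r * K)"
    and "f1 \<in> Lp_space r \<Omega>" and "f2 \<in> Lp_space r \<Omega>"
    and "u1 \<in> Lp_space r (\<Omega> \<union> \<Gamma>)" and "u2 \<in> Lp_space r (\<Omega> \<union> \<Gamma>)"
    and "g \<in> borel_measurable (lebesgue_on \<Gamma>)"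
    and "solves_nonlocal_dirichlet \<mu> \<Omega> \<Gamma> f1 g u1"
    and "solves_nonlocal_dirichlet \<mu> \<Omega> \<Gamma> f2 g u2"
  shows "Lp_norm r \<Omega> (\<lambda>x. u2 x - u1 x) \<le> C2 * Lp_norm r \<Omega> (\<lambda>x. f2 x - f1 x)"
proof -
  note r = \<open>r \<ge> 1\<close> and \<mu>0 = \<open>\<And>x y. \<mu> x y \<ge> 0\<close>
  note G = \<open>Linf_norm UNIV (gamma_ker \<mu>) < \<infinity>\<close> and L = \<open>Linf_norm UNIV (lambda_ker \<mu>) < \<infinity>\<close>
  have \<Omega>: "\<Omega> \<in> sets lebesgue" using \<open>open \<Omega>\<close> by simp
  hence S: "\<Omega> \<union> \<Gamma> \<in> sets lebesgue" using \<open>\<Gamma> \<in> sets lebesgue\<close> by simp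
  have \<mu>: "(\<lambda>(x, y). \<mu> x y) \<in> borel_measurable lebesgue"
    using Lp_spaceD(1)[OF \<open>(\<lambda>(x, y). \<mu> x y) \<in> Lp_space 1 UNIV\<close>] by (simp add: lebesgue_on_UNIV_eq)
  note schur = nonlocal_schur_test[OF r \<mu>0 \<mu> G L]
  define U1 where "U1 = zero_ext (\<Omega> \<union> \<Gamma>) u1"
  define U2 where "U2 = zero_ext (\<Omega> \<union> \<Gamma>) u2"
  define W where "W = (\<lambda>x. U2 x - U1 x)"
  define F where "F = (\<lambda>x. f2 x - f1 x)"
  define T where "T = (\<lambda>x. \<integral>y. W y * \<mu> x y \<partial>lebesgue)"
  have U1: "U1 \<in> Lp_space r UNIV" and U2: "U2 \<in> Lp_space r UNIV"
    unfolding U1_def U2_def using S assms by (auto intro: zero_ext_in_Lp_space)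
  have W: "W \<in> Lp_space r UNIV" unfolding W_def by (rule Lp_space_diff[OF r U2 U1])
  have F: "F \<in> Lp_space r \<Omega>" unfolding F_def using assms by (intro Lp_space_diff)
  have T: "T \<in> Lp_space r UNIV" "Lp_norm r UNIV T \<le> M_const \<mu> r * Lp_norm r UNIV W"
    unfolding T_def using schur(2,3)[OF W] by auto
  have K0: "K \<ge> 0" by (simp add: K_eq)
  have "AE x in lebesgue_on (\<Omega> \<union> \<Gamma>). 1 / lambda_ker \<mu> x \<le> ennreal K"
    using esssup_AE[of "\<lambda>x. 1 / lambda_ker \<mu> x" "lebesgue_on (\<Omega> \<union> \<Gamma>)"]
      \<open>Linf_norm (\<Omega> \<union> \<Gamma>) (\<lambda>x. 1 / lambda_ker \<mu> x) < \<infinity>\<close>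
    by (simp add: K_eq Linf_norm_def less_top)
  hence rec: "AE x in lebesgue. x \<in> \<Omega> \<longrightarrow> 1 / lambda_ker \<mu> x \<le> ennreal K"
    using S by (auto simp: AE_restrict_space_iff elim!: eventually_mono)
  have slice: "AE x in lebesgue. integrable lebesgue (\<mu> x)"
    using \<open>AE x in lebesgue. \<mu> x \<in> Lp_space 1 UNIV\<close>
    using \<mu>0 by (auto elim!: eventually_mono simp: Lp_space_def lebesgue_on_UNIV_eq)
  have eqs: "AE x in lebesgue. x \<in> \<Omega> \<longrightarrow> nonlocal_laplacian \<mu> U1 x = f1 x"
    "AE x in lebesgue. x \<in> \<Omega> \<longrightarrow> nonlocal_laplacian \<mu> U2 x = f2 x"
    "AE x in lebesgue. x \<in> \<Gamma> \<longrightarrow> u1 x = g x" "AE x in lebesgue. x \<in> \<Gamma> \<longrightarrow> u2 x = g x"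
    using assms by (auto simp: solves_nonlocal_dirichlet_def U1_def U2_def)
  have "AE x in lebesgue. x \<in> \<Omega> \<longrightarrow> \<bar>W x\<bar> \<le> K * (\<bar>T x\<bar> + \<bar>F x\<bar>)"
    using eqs(1,2) rec slice schur(1)[OF U1] schur(1)[OF U2]
  proof eventually_elim
    case (elim x)
    show ?case
    proof
      assume x: "x \<in> \<Omega>"
      have "T x = (\<integral>y. U2 y * \<mu> x y \<partial>lebesgue) - (\<integral>y. U1 y * \<mu> x y \<partial>lebesgue)"
        using elim by (simp add: T_def W_def left_diff_distrib)
      hence "T x - W x * (\<integral>y. \<mu> x y \<partial>lebesgue) = F x"
        using elim x by (simp add: nonlocal_laplacian_eq W_def F_def algebra_simps)
      thus "\<bar>W x\<bar> \<le> K * (\<bar>T x\<bar> + \<bar>F x\<bar>)"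
        using elim x \<mu>0 K0 by (intro abs_le_of_reciprocal_bound) auto
    qed
  qed
  hence "AE x in lebesgue_on \<Omega>. \<bar>W x\<bar> \<le> \<bar>K * T x\<bar> + \<bar>K * F x\<bar>"
    using \<Omega> K0 by (auto simp: AE_restrict_space_iff abs_mult distrib_left elim!: eventually_mono)
  hence "Lp_norm r \<Omega> W \<le> Lp_norm r \<Omega> (\<lambda>x. K * T x) + Lp_norm r \<Omega> (\<lambda>x. K * F x)"
    unfolding Lp_norm_def using \<Omega> r K0 W T F
    by (intro minkowski_dominated[OF r] Lp_spaceD(2)[OF Lp_space_cmult] Lp_spaceD(2)
        Lp_norm_mono_set(1)[OF \<Omega> r W] Lp_norm_mono_set(1)[OF \<Omega> r T(1)])
  also have "\<dots> = K * Lp_norm r \<Omega> T + K * Lp_norm r \<Omega> F"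
    using K0 r by (simp add: Lp_norm_cmult)
  also have "\<dots> \<le> K * (M_const \<mu> r * Lp_norm r UNIV W) + K * Lp_norm r \<Omega> F"
    using Lp_norm_mono_set(2)[OF \<Omega> r T(1)] T(2) K0 by (intro add_right_mono mult_left_mono) auto
  \<comment> \<open>The common boundary values turn the global norm into the one on \<open>\<Omega>\<close>, so that it can be absorbed.\<close>
  also have "Lp_norm r UNIV W = Lp_norm r \<Omega> W"
  proof (rule Lp_norm_eq_of_AE_zero_outside[OF \<Omega>])
    show "W \<in> borel_measurable lebesgue" using Lp_spaceD(1)[OF W] by (simp add: lebesgue_on_UNIV_eq)
    show "AE x in lebesgue. x \<notin> \<Omega> \<longrightarrow> W x = 0"
      using eqs(3,4) by eventually_elim (auto simp: W_def U1_def U2_def zero_ext_def)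
  qed
  finally have "(1 - M_const \<mu> r * K) * Lp_norm r \<Omega> W \<le> K * Lp_norm r \<Omega> F"
    by (simp add: algebra_simps)
  hence "Lp_norm r \<Omega> W \<le> C2 * Lp_norm r \<Omega> F"
    using \<open>1 - M_const \<mu> r * K > 0\<close> by (simp add: C2_eq field_simps)
  moreover have "Lp_norm r \<Omega> W = Lp_norm r \<Omega> (\<lambda>x. u2 x - u1 x)"
    unfolding Lp_norm_def W_def U1_def U2_def zero_ext_def
    by (intro arg_cong2[where f = "(powr)"] Bochner_Integration.integral_cong) auto
  ultimately show ?thesis by (simp add: F_def)
qed

end
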